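(* Let $n\ge 1$ and $p\ge1$ be integers, let $L>m>0$, $\kappa=L/m$, and put $$\rho=\left(\frac{\sqrt L-\sqrt m}{\sqrt L+\sqrt m}\right)^{1/n},\quad \tilde K_1=\frac{(\sqrt L+\sqrt m)^2}{4Lm},\quad \tilde K_2=\frac{(\sqrt L-\sqrt m)^2}{4Lm},\quad \tilde K_3=\frac{L+m}{2Lm}.$$ Then there exists an algorithm $\Sigma(\alpha^*,\beta^*,m,L)$ of the form $$x(t+1)=x(t)+\sum_{j=0}^{k-1}\beta_j\big(x(t-j)-x(t-j-1)\big)-\sum_{j=0}^{k}\alpha_j\nabla_x f(x(t-j),t-j),\qquad \sum_{j=0}^k\alpha_j\neq 0,$$ which is globally convergent with zero steady-state error for every $f\in\mathscr{F}^q_{m,L}$ and has convergence rate $$r(\alpha^*,\beta^*,m,L)=\left(\frac{\sqrt{\kappa}-1}{\sqrt{\kappa}+1}\right)^{1/n}=\left(\frac{\sqrt{L}-\sqrt{m}}{\sqrt{L}+\sqrt{m}}\right)^{1/n}.$$ Specifically, these properties hold for $k=2n-1$ with $$\alpha_j=\tilde K_1\binom{2n}{j+1}(-\rho^2)^{j+1}+\tilde K_2\binom{2n}{j+1}(-1)^{j+1}-\tilde K_3\sum_{i=0}^{j+1}\binom ni\binom n{j+1-i}(-\rho^2)^i(-1)^{j+1-i},\quad j=0,1,\dots,2n-1,$$ $$\beta_j=-\sum_{i=0}^{j+1}\binom ni\binom{n-1}{j+1-i}(-\rho^2)^i(-1)^{j+1-i},\quad j=0,1,\dots,2n-2,$$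 where $\binom{a}{b}=0$ for $b>a$.
   Context: Class of cost functions. $\mathscr{F}^q_{m,L}$ (for the fixed $n,p$) is the set of all functions $f(x,t)=\tfrac12 (x-x^*(t))^T\Delta(x-x^*(t))+c(x^*(t))$, $x\in\mathbb{R}^p$, where $\Delta=\Delta^T\in\mathbb{R}^{p\times p}$ satisfies $mI\le\Delta\le LI$, $x^*(t)=a_0+a_1t+\dots+a_{n-1}t^{n-1}$ with arbitrary constant vectors $a_i\in\mathbb{R}^p$, and $c(x^*(t))\in\mathbb{R}$. Algorithm. $k\ge 1$ is an integer, $\alpha=(\alpha_0,\dots,\alpha_k)$, $\beta=(\beta_0,\dots,\beta_{k-1})$ are real parameters not depending on $f$. The recursion is initialized with arbitrary $x(0),\dots,x(k)\in\mathbb{R}^p$ and run for $t=k,k+1,\dots$. It is globally convergent with zero steady-state error for $f$ if $x(t)-x^*(t)\to 0$ as $t\to\infty$ for all initial values. Convergence rate. For symmetric $\Delta\in\mathbb{R}^{p\times p}$, let $\hat A(\Delta)\in\mathbb{R}^{(k+1)p\times(k+1)p}$ be the block companion matrix of the recursion $$\tilde x(t+1)=\tilde x(t)+\sum_{j=0}^{k-1}\beta_j(\tilde x(t-j)-\tilde x(t-j-1))-\sum_{j=0}^k\alpha_j\Delta\tilde x(t-j),$$ i.e. the matrix with $\chi(t+1)=\hat A(\Delta)\chi(t)$ for $\chi(t)=[\tilde x(t-k)^T\ \cdots\ \tilde x(t)^T]^T$. Then $r(\alpha,\beta,m,L)=\sup_{mI\le\Delta\le LI}\rho(\hat A(\Delta))$,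 where $\rho(\cdot)$ applied to a matrix denotes the spectral radius (the number $\rho$ in the claim is a separate constant). *)

theory Defs
  imports
    "Jordan_Normal_Form.Spectral_Radius"
    "HOL-Analysis.Analysis"
begin

no_notation vec_index (infixl \<open>$\<close> 100)
no_notation scalar_prod (infix \<open>\<bullet>\<close> 70)

text \<open>
  The space of decision variables is \<^typ>\<open>real ^ 'p\<close>, so that the dimension is
  \<^term>\<open>CARD('p)\<close>. Time is discrete and starts at 0.
\<close>

section \<open>Cost functions\<close>

definition psd_le :: "real ^ 'p ^ 'p \<Rightarrow> real ^ 'p ^ 'p \<Rightarrow> bool" where
  "psd_le A B \<longleftrightarrow> (\<forall>x. 0 \<le> x \<bullet> ((B - A) *v x))"

definition sandwiched :: "real \<Rightarrow> real \<Rightarrow> (real ^ 'p ^ 'p) set" where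
  "sandwiched m L =
     {\<Delta>. transpose \<Delta> = \<Delta> \<and>
        psd_le (m *\<^sub>R Finite_Cartesian_Product.mat 1) \<Delta> \<and>
        psd_le \<Delta> (L *\<^sub>R Finite_Cartesian_Product.mat 1)}"

text \<open>
  \<open>quad_cost n m L xs f\<close>: the function \<open>f\<close> belongs to the class of quadratic costs, and
  \<open>xs\<close> is the polynomial trajectory \<open>x\<^sup>*\<close> in its representation. For \<open>m > 0\<close>, \<open>xs t\<close> is the
  unique minimizer of \<open>\<lambda>x. f x t\<close>, so \<open>f\<close> determines \<open>xs\<close>.
\<close>
definition quad_cost ::
  "nat \<Rightarrow> real \<Rightarrow> real \<Rightarrow> (nat \<Rightarrow> real ^ 'p) \<Rightarrow> (real ^ 'p \<Rightarrow> nat \<Rightarrow> real) \<Rightarrow> bool" where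
  "quad_cost n m L xs f \<longleftrightarrow>
     (\<exists>\<Delta> \<in> sandwiched m L. \<exists>(a :: nat \<Rightarrow> real ^ 'p) (c :: real ^ 'p \<Rightarrow> real).
        xs = (\<lambda>t. \<Sum>i<n. (real t ^ i) *\<^sub>R a i) \<and>
        f = (\<lambda>x t. 1/2 * ((x - xs t) \<bullet> (\<Delta> *v (x - xs t))) + c (xs t)))"

definition quad_class :: "nat \<Rightarrow> real \<Rightarrow> real \<Rightarrow> (real ^ 'p \<Rightarrow> nat \<Rightarrow> real) set" where
  "quad_class n m L = {f. \<exists>xs. quad_cost n m L xs f}"

section \<open>The algorithm\<close>

definition gradient :: "('a::real_inner \<Rightarrow> real) \<Rightarrow> 'a \<Rightarrow> 'a" where
  "gradient g x = (THE D. GDERIV g x :> D)"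

text \<open>
  \<open>recursion k \<alpha> \<beta> G x\<close>: the sequence \<open>x\<close> obeys the algorithm from time \<open>k\<close> on, where
  \<open>G y s\<close> is the gradient at the point \<open>y\<close> and time \<open>s\<close>. The values
  \<open>x 0, \<dots>, x k\<close> are unconstrained.
\<close>
definition recursion ::
  "nat \<Rightarrow> (nat \<Rightarrow> real) \<Rightarrow> (nat \<Rightarrow> real) \<Rightarrow> (real ^ 'p \<Rightarrow> nat \<Rightarrow> real ^ 'p) \<Rightarrow>
   (nat \<Rightarrow> real ^ 'p) \<Rightarrow> bool" where
  "recursion k \<alpha> \<beta> G x \<longleftrightarrow>
     (\<forall>t\<ge>k. x (t + 1) = x t + (\<Sum>j<k. \<beta> j *\<^sub>R (x (t - j) - x (t - j - 1)))
                        - (\<Sum>j\<le>k. \<alpha> j *\<^sub>R G (x (t - j)) (t - j)))"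

definition globally_convergent ::
  "nat \<Rightarrow> (nat \<Rightarrow> real) \<Rightarrow> (nat \<Rightarrow> real) \<Rightarrow> (real ^ 'p \<Rightarrow> nat \<Rightarrow> real) \<Rightarrow>
   (nat \<Rightarrow> real ^ 'p) \<Rightarrow> bool" where
  "globally_convergent k \<alpha> \<beta> f xs \<longleftrightarrow>
     (\<forall>x. recursion k \<alpha> \<beta> (\<lambda>y s. gradient (\<lambda>z. f z s) y) x \<longrightarrow>
        (\<lambda>t. x t - xs t) \<longlonglongrightarrow> 0)"

section \<open>Convergence rate\<close>

text \<open>
  \<open>from_nat_into UNIV\<close> enumerates the finite index type \<open>'p\<close> by \<open>0, \<dots>, CARD('p) - 1\<close>, so
  that a block matrix with blocks in \<^typ>\<open>real ^ 'p ^ 'p\<close> becomes a matrix with \<open>nat\<close>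
  indices. Another enumeration would give a similar matrix, with the same spectral radius.
\<close>
definition block_mat :: "nat \<Rightarrow> (nat \<Rightarrow> nat \<Rightarrow> real ^ 'p ^ 'p) \<Rightarrow> real Matrix.mat" where
  "block_mat N B = Matrix.mat (N * CARD('p)) (N * CARD('p))
     (\<lambda>(r, c). B (r div CARD('p)) (c div CARD('p))
        $ from_nat_into UNIV (r mod CARD('p)) $ from_nat_into UNIV (c mod CARD('p)))"

definition block_vec :: "nat \<Rightarrow> (nat \<Rightarrow> real ^ 'p) \<Rightarrow> real Matrix.vec" where
  "block_vec N v = Matrix.vec (N * CARD('p))
     (\<lambda>r. v (r div CARD('p)) $ from_nat_into UNIV (r mod CARD('p)))"

text \<open>The matrix coefficient of \<open>x (t - j)\<close> in the recursion with \<open>G y s = \<Delta> *v y\<close>.\<close>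
definition lag_coeff ::
  "nat \<Rightarrow> (nat \<Rightarrow> real) \<Rightarrow> (nat \<Rightarrow> real) \<Rightarrow> real ^ 'p ^ 'p \<Rightarrow> nat \<Rightarrow> real ^ 'p ^ 'p" where
  "lag_coeff k \<alpha> \<beta> \<Delta> j =
     ((if j = 0 then 1 else 0) + (if j < k then \<beta> j else 0) - (if 0 < j then \<beta> (j - 1) else 0))
       *\<^sub>R Finite_Cartesian_Product.mat 1
     - \<alpha> j *\<^sub>R \<Delta>"

text \<open>
  The state stacks \<open>x (t - k), \<dots>, x t\<close> in this order; see \<open>companion_step\<close> below.
\<close>
definition companion ::
  "nat \<Rightarrow> (nat \<Rightarrow> real) \<Rightarrow> (nat \<Rightarrow> real) \<Rightarrow> real ^ 'p ^ 'p \<Rightarrow> real Matrix.mat" where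
  "companion k \<alpha> \<beta> \<Delta> = block_mat (k + 1)
     (\<lambda>i j. if i < k then (if j = i + 1 then Finite_Cartesian_Product.mat 1 else 0)
            else lag_coeff k \<alpha> \<beta> \<Delta> (k - j))"

text \<open>
  The supremum is over a nonempty set when \<open>m \<le> L\<close>, and it is bounded since the matrices
  \<open>\<Delta>\<close> range over a compact set.
\<close>
definition conv_rate ::
  "'p::finite itself \<Rightarrow> nat \<Rightarrow> (nat \<Rightarrow> real) \<Rightarrow> (nat \<Rightarrow> real) \<Rightarrow> real \<Rightarrow> real \<Rightarrow> real" where
  "conv_rate _ k \<alpha> \<beta> m L =
     (SUP \<Delta> \<in> (sandwiched m L :: (real ^ 'p ^ 'p) set).
        spectral_radius (map_mat complex_of_real (companion k \<alpha> \<beta> \<Delta>)))"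

lemma block_mat_mult_vec:
  fixes B :: "nat \<Rightarrow> nat \<Rightarrow> real ^ 'p ^ 'p" and v :: "nat \<Rightarrow> real ^ 'p"
  shows "block_mat N B *\<^sub>v block_vec N v = block_vec N (\<lambda>i. \<Sum>j<N. B i j *v v j)"
proof (rule eq_vecI)
  let ?p = "CARD('p)" and ?e = "from_nat_into (UNIV :: 'p set)"
  fix r assume "r < dim_vec (block_vec N (\<lambda>i. \<Sum>j<N. B i j *v v j))"
  hence r: "r < N * ?p" by (simp add: block_vec_def)
  let ?g = "\<lambda>c. B (r div ?p) (c div ?p) $ ?e (r mod ?p) $ ?e (c mod ?p)
                 * (v (c div ?p) $ ?e (c mod ?p))"
  have inner_sum: "sum ?g {j * ?p..<j * ?p + ?p} = (B (r div ?p) j *v v j) $ ?e (r mod ?p)" for j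
  proof -
    have "sum ?g {j * ?p..<j * ?p + ?p} = (\<Sum>s<?p. ?g (s + j * ?p))"
      using sum.shift_bounds_nat_ivl[of ?g 0 "j * ?p" ?p]
      by (simp add: add.commute lessThan_atLeast0)
    also have "\<dots> = (\<Sum>s<?p. B (r div ?p) j $ ?e (r mod ?p) $ ?e s * (v j $ ?e s))"
      by (intro sum.cong) auto
    also have "\<dots> = (\<Sum>q\<in>UNIV. B (r div ?p) j $ ?e (r mod ?p) $ q * (v j $ q))"
      by (rule sum.reindex_bij_betw[OF bij_betw_from_nat_into_finite]) simp
    finally show ?thesis by (simp add: matrix_vector_mult_def)
  qed
  have "vec_index (block_mat N B *\<^sub>v block_vec N v) r = sum ?g {..<N * ?p}"
    using r by (simp add: block_mat_def block_vec_def scalar_prod_def lessThan_atLeast0)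
  also have "\<dots> = (\<Sum>j<N. sum ?g {j * ?p..<j * ?p + ?p})"
    by (rule sum.nat_group[symmetric])
  finally show "vec_index (block_mat N B *\<^sub>v block_vec N v) r
      = vec_index (block_vec N (\<lambda>i. \<Sum>j<N. B i j *v v j)) r"
    using r by (simp add: inner_sum block_vec_def)
qed (simp add: block_mat_def block_vec_def)

lemma sum_lag_coeff:
  "(\<Sum>j\<le>k. lag_coeff k \<alpha> \<beta> \<Delta> j *v y j)
     = y 0 + (\<Sum>j<k. \<beta> j *\<^sub>R (y j - y (j + 1))) - (\<Sum>j\<le>k. \<alpha> j *\<^sub>R (\<Delta> *v y j))"
proof -
  have "lag_coeff k \<alpha> \<beta> \<Delta> j *v y j
      = (if j = 0 then y 0 else 0) + (if j < k then \<beta> j *\<^sub>R y j else 0)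
        - (if 0 < j then \<beta> (j - 1) *\<^sub>R y j else 0) - \<alpha> j *\<^sub>R (\<Delta> *v y j)" for j
    by (simp add: lag_coeff_def matrix_vector_mult_add_rdistrib
        matrix_vector_mult_diff_rdistrib scaleR_matrix_vector_assoc[symmetric]
        scaleR_left_distrib scaleR_left_diff_distrib)
  hence "(\<Sum>j\<le>k. lag_coeff k \<alpha> \<beta> \<Delta> j *v y j)
      = (\<Sum>j\<le>k. if j = 0 then y 0 else 0) + (\<Sum>j\<le>k. if j < k then \<beta> j *\<^sub>R y j else 0)
        - (\<Sum>j\<le>k. if 0 < j then \<beta> (j - 1) *\<^sub>R y j else 0) - (\<Sum>j\<le>k. \<alpha> j *\<^sub>R (\<Delta> *v y j))"
    by (simp add: sum.distrib sum_subtractf)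
  moreover have "(\<Sum>j\<le>k. if j < k then \<beta> j *\<^sub>R y j else 0) = (\<Sum>j<k. \<beta> j *\<^sub>R y j)"
    by (simp add: lessThan_Suc_atMost[symmetric])
  moreover have "(\<Sum>j\<le>k. if 0 < j then \<beta> (j - 1) *\<^sub>R y j else 0) = (\<Sum>j<k. \<beta> j *\<^sub>R y (j + 1))"
    by (subst sum.atMost_shift) simp
  ultimately show ?thesis
    by (simp add: scaleR_right_diff_distrib sum_subtractf)
qed

lemma companion_step:
  fixes x :: "nat \<Rightarrow> real ^ 'p"
  assumes "recursion k \<alpha> \<beta> (\<lambda>y s. \<Delta> *v y) x" and "k \<le> t"
  shows "companion k \<alpha> \<beta> \<Delta> *\<^sub>v block_vec (k + 1) (\<lambda>i. x (t - k + i))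
       = block_vec (k + 1) (\<lambda>i. x (t + 1 - k + i))"
proof -
  let ?B = "\<lambda>i j. if i < k then (if j = i + 1 then Finite_Cartesian_Product.mat 1 else 0)
            else lag_coeff k \<alpha> \<beta> \<Delta> (k - j)"
  have row: "(\<Sum>j<k + 1. ?B i j *v x (t - k + j)) = x (t + 1 - k + i)" if "i < k + 1" for i
  proof (cases "i < k")
    case True
    hence "(\<Sum>j<k + 1. ?B i j *v x (t - k + j))
        = (\<Sum>j<k + 1. if j = i + 1 then x (t - k + j) else 0)"
      by (intro sum.cong) auto
    also have "\<dots> = x (t + 1 - k + i)"
      using True assms(2) by (simp add: Suc_diff_le)
    finally show ?thesis .
  next
    case False
    with that have i: "i = k" by simp
    have "(\<Sum>j<k + 1. ?B i j *v x (t - k + j))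
        = (\<Sum>j\<le>k. lag_coeff k \<alpha> \<beta> \<Delta> (k - j) *v x (t - (k - j)))"
      using assms(2) by (intro sum.cong) (auto simp: i)
    also have "\<dots> = (\<Sum>j\<le>k. lag_coeff k \<alpha> \<beta> \<Delta> j *v x (t - j))"
      using sum.nat_diff_reindex[of "\<lambda>j. lag_coeff k \<alpha> \<beta> \<Delta> j *v x (t - j)" "k + 1"]
      by (simp add: lessThan_Suc_atMost)
    also have "\<dots> = x (t + 1)"
      using assms by (simp add: sum_lag_coeff recursion_def)
    finally show ?thesis using assms(2) by (simp add: i)
  qed
  have eq: "r div CARD('p) < k + 1" if "r < (k + 1) * CARD('p)" for r
    using that by (simp add: less_mult_imp_div_less)
  show ?thesis
    unfolding companion_def block_mat_mult_vec
    by (intro eq_vecI) (simp_all only: block_vec_def dim_vec index_vec split row[OF eq])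
qed

section \<open>Optimal parameters\<close>

definition rho :: "nat \<Rightarrow> real \<Rightarrow> real \<Rightarrow> real" where
  "rho n m L = ((sqrt L - sqrt m) / (sqrt L + sqrt m)) powr (1 / real n)"

definition K1 :: "real \<Rightarrow> real \<Rightarrow> real" where
  "K1 m L = (sqrt L + sqrt m)\<^sup>2 / (4 * L * m)"

definition K2 :: "real \<Rightarrow> real \<Rightarrow> real" where
  "K2 m L = (sqrt L - sqrt m)\<^sup>2 / (4 * L * m)"

definition K3 :: "real \<Rightarrow> real \<Rightarrow> real" where
  "K3 m L = (L + m) / (2 * L * m)"

definition alpha_opt :: "nat \<Rightarrow> real \<Rightarrow> real \<Rightarrow> nat \<Rightarrow> real" where
  "alpha_opt n m L j =
     K1 m L * real ((2 * n) choose (j + 1)) * (- (rho n m L)\<^sup>2) ^ (j + 1)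
     + K2 m L * real ((2 * n) choose (j + 1)) * (- 1) ^ (j + 1)
     - K3 m L * (\<Sum>i = 0..j + 1. real (n choose i) * real (n choose (j + 1 - i))
                    * (- (rho n m L)\<^sup>2) ^ i * (- 1) ^ (j + 1 - i))"

definition beta_opt :: "nat \<Rightarrow> real \<Rightarrow> real \<Rightarrow> nat \<Rightarrow> real" where
  "beta_opt n m L j =
     - (\<Sum>i = 0..j + 1. real (n choose i) * real ((n - 1) choose (j + 1 - i))
          * (- (rho n m L)\<^sup>2) ^ i * (- 1) ^ (j + 1 - i))"

end

theory Submission
  imports Defs
begin

text \<open>
  Let \<open>A = (z - \<rho>\<^sup>2) ^ n\<close> and \<open>B = (z - 1) ^ n\<close>. For an eigenvector of the companion matrix to the
  eigenvalue \<open>z\<close>, the parameters are chosen so that \<open>A B + c (K1 A\<^sup>2 + K2 B\<^sup>2 - K3 A B) = 0\<close>, where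
  \<open>c \<in> [m, L]\<close> is a Rayleigh quotient of \<open>\<Delta>\<close>. As a real quadratic equation in \<open>A / B\<close> this has
  discriminant \<open>(1 - c / m) (1 - c / L) \<le> 0\<close>. Its roots are therefore conjugate, of modulus
  \<open>sqrt (K2 / K1) = \<rho> ^ n\<close>, so \<open>\<bar>z - \<rho>\<^sup>2\<bar> = \<rho> \<bar>z - 1\<bar>\<close>, which is the Apollonius circle
  \<open>\<bar>z\<bar> = \<rho>\<close>: for every \<open>\<Delta>\<close>, all eigenvalues have modulus \<open>\<rho>\<close>. The factor \<open>(z - 1) ^ n\<close> of
  \<open>A B\<close> annihilates the trajectory \<open>x\<^sup>*\<close>, whose degree is below \<open>n\<close>, so the error obeys the
  homogeneous linear recursion and tends to 0 because \<open>\<rho> < 1\<close>.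
\<close>

section \<open>Polynomial trajectories and reversed polynomials\<close>

text \<open>\<open>pCons 0 (pderiv p)\<close> is the Euler operator x p'(x), which multiplies the
  coefficient of index i by i. Differentiation lowers the multiplicity of the root 1 by at most
  one.\<close>

lemma linear_power_dvd_euler:
  fixes p :: "'a::idom poly"
  assumes "[:1, -1:] ^ Suc n dvd p"
  shows "[:1, -1:] ^ n dvd pCons 0 (pderiv p)"
proof -
  obtain q where q: "p = [:1, -1:] ^ Suc n * q" using assms by (elim dvdE)
  have "pderiv p = [:1, -1:] ^ n * (Polynomial.smult (of_nat (Suc n)) (pderiv [:1, -1:] * q) + [:1, -1:] * pderiv q)"
    unfolding q pderiv_mult pderiv_power_Suc
    by (simp only: smult_add_right power_Suc mult_smult_left mult_smult_right distrib_left mult.assoc mult.left_commute mult.commute add.commute)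
  moreover have "pCons 0 (pderiv p) = [:0, 1:] * pderiv p" by simp
  ultimately show ?thesis by (simp only: dvd_mult dvd_triv_left)
qed

text \<open>Split q = a + x r. The constant a contributes a multiple of p(1) = 0. The factor i in i
  r(i) moves into p as the Euler operator, which costs one order of the zero at 1 just as r loses
  one degree. The alternative \<open>q = 0\<close> is needed because the zero polynomial has degree
  0.\<close>

lemma sum_coeff_mult_poly_eq_0:
  fixes p q :: "real poly"
  assumes "[:1, -1:] ^ n dvd p" and "degree p \<le> N" and "q = 0 \<or> degree q < n"
  shows "(\<Sum>i\<le>N. coeff p i * poly q (real i)) = 0"
  using assms
proof (induction n arbitrary: p q)
  case 0
  then show ?case by simp
next
  case (Suc n)
  obtain a r where q: "q = pCons a r" by (cases q)
  have r: "r = 0 \<or> degree r < n"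
    using Suc.prems(3) by (auto simp: q split: if_splits)
  have "poly p 1 = 0"
    using Suc.prems(1) by (auto elim!: dvdE)
  hence 1: "(\<Sum>i\<le>N. coeff p i) = 0"
    using poly_altdef[of p 1] sum.mono_neutral_left[of "{..N}" "{..degree p}" "coeff p"] Suc.prems(2)
    by (auto simp: coeff_eq_0)
  let ?e = "pCons 0 (pderiv p)"
  have e: "coeff ?e i = real i * coeff p i" for i
    by (cases i) (auto simp: coeff_pderiv)
  have "degree ?e \<le> N"
    by (rule degree_le) (use Suc.prems(2) in \<open>auto simp: e coeff_eq_0 simp del: coeff_pCons\<close>)
  from Suc.IH[OF linear_power_dvd_euler[OF Suc.prems(1)] this r]
  have 2: "(\<Sum>i\<le>N. real i * coeff p i * poly r (real i)) = 0" by (simp add: e)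
  have "(\<Sum>i\<le>N. coeff p i * poly q (real i))
      = a * (\<Sum>i\<le>N. coeff p i) + (\<Sum>i\<le>N. real i * coeff p i * poly r (real i))"
    unfolding sum_distrib_left sum.distrib[symmetric]
    by (intro sum.cong) (simp_all add: q algebra_simps)
  then show ?case using 1 2 by simp
qed

text \<open>Read as weights on the lags i, the coefficients of p annihilate trajectories of degree
  below n, since (T - i)^d is a polynomial in i of degree at most d. The bound
  \<open>N \<le> T\<close> keeps the subtraction of naturals exact.\<close>

lemma sum_coeff_scaleR_trajectory_eq_0:
  fixes p :: "real poly" and a :: "nat \<Rightarrow> 'a::real_vector"
  assumes "[:1, -1:] ^ n dvd p" and "degree p \<le> N" and "N \<le> T"
  shows "(\<Sum>i\<le>N. coeff p i *\<^sub>R (\<Sum>d<n. (real (T - i) ^ d) *\<^sub>R a d)) = 0"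
proof -
  have "(\<Sum>i\<le>N. coeff p i * real (T - i) ^ d) = 0" if "d < n" for d
  proof -
    have "degree ([:real T, -1:] ^ d) \<le> d"
      using degree_power_le[of "[:real T, -1:]" d] by simp
    with that have "degree ([:real T, -1:] ^ d) < n" by simp
    from sum_coeff_mult_poly_eq_0[OF assms(1,2) disjI2[OF this]] assms(3)
    show ?thesis by (simp add: of_nat_diff)
  qed
  hence "(\<Sum>d<n. (\<Sum>i\<le>N. coeff p i * real (T - i) ^ d) *\<^sub>R a d) = 0" by simp
  thus ?thesis
    unfolding scaleR_sum_left scaleR_sum_right scaleR_scaleR by (rule trans[OF sum.swap])
qed

text \<open>Evaluates the reversed polynomial, where the nominal degree \<open>N\<close> may exceed the degree.\<close>

definition rev_eval :: "nat \<Rightarrow> real poly \<Rightarrow> complex \<Rightarrow> complex" where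
  "rev_eval N p z = (\<Sum>i\<le>N. of_real (coeff p i) * z ^ (N - i))"

lemma rev_eval_add: "rev_eval N (p + q) z = rev_eval N p z + rev_eval N q z"
  and rev_eval_diff: "rev_eval N (p - q) z = rev_eval N p z - rev_eval N q z"
  and rev_eval_smult: "rev_eval N (Polynomial.smult c p) z = of_real c * rev_eval N p z"
  by (simp_all add: rev_eval_def algebra_simps sum.distrib sum_subtractf sum_distrib_left)

text \<open>Reversal turns a factor 1 + c x in the lag variable into z + c. The degree bound makes
  the coefficient of index \<open>Suc N\<close> vanish, so raising the nominal degree just
  multiplies by z.\<close>

lemma rev_eval_linear_mult:
  assumes "degree p \<le> N"
  shows "rev_eval (Suc N) ([:1, c:] * p) z = (z + of_real c) * rev_eval N p z"
proof -
  have "[:1, c:] * p = p + Polynomial.smult c (pCons 0 p)" by simp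
  hence "rev_eval (Suc N) ([:1, c:] * p) z
      = rev_eval (Suc N) p z + of_real c * rev_eval (Suc N) (pCons 0 p) z"
    by (simp only: rev_eval_add rev_eval_smult)
  also have "rev_eval (Suc N) (pCons 0 p) z = rev_eval N p z"
    unfolding rev_eval_def by (subst sum.atMost_Suc_shift) simp
  also have "rev_eval (Suc N) p z = z * rev_eval N p z"
    using assms by (simp add: rev_eval_def coeff_eq_0 sum_distrib_left Suc_diff_le algebra_simps)
  finally show ?thesis by (simp add: algebra_simps)
qed

lemma degree_linear_power_le: "degree ([:a, b:] ^ n) \<le> n"
proof -
  have "degree [:a, b:] * n \<le> 1 * n" by (intro mult_right_mono) auto
  with degree_power_le[of "[:a, b:]" n] show ?thesis by linarith
qed

lemma rev_eval_linear_power_mult: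
  assumes "degree p \<le> N"
  shows "rev_eval (k + N) ([:1, c:] ^ k * p) z = (z + of_real c) ^ k * rev_eval N p z"
proof (induction k)
  case 0
  then show ?case by simp
next
  case (Suc k)
  have "degree ([:1, c:] ^ k * p) \<le> k + N"
    using degree_mult_le[of "[:1, c:] ^ k" p] degree_linear_power_le[of 1 c k] assms by linarith
  from rev_eval_linear_mult[OF this, of c z] Suc show ?case
    by (simp only: power_Suc mult.assoc add_Suc)
qed

lemma rev_eval_linear_powers:
  "rev_eval (k + l) ([:1, c:] ^ k * [:1, d:] ^ l) z = (z + of_real c) ^ k * (z + of_real d) ^ l"
  using rev_eval_linear_power_mult[OF degree_linear_power_le[of 1 d l], of k c z]
    rev_eval_linear_power_mult[of 1 0 l d z]
  by (simp add: rev_eval_def)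

text \<open>The roots are conjugate or coincide, so the squared modulus is their product c / a. This
  amounts to 2 a Re u + b = 0, which the imaginary part of the equation gives unless u is
  real.\<close>

lemma root_modulus_quadratic:
  fixes u :: complex and a b c :: real
  assumes "0 < a" and "b\<^sup>2 \<le> 4 * a * c" and "of_real a * u\<^sup>2 + of_real b * u + of_real c = 0"
  shows "a * (cmod u)\<^sup>2 = c"
proof -
  obtain x y where u: "u = Complex x y" by (cases u)
  have re: "a * (x\<^sup>2 - y\<^sup>2) + b * x + c = 0" and im: "y * (2 * a * x + b) = 0"
    using assms(3) by (auto simp: u complex_eq_iff power2_eq_square algebra_simps)
  have x: "2 * a * x + b = 0"
  proof (cases "y = 0")
    case True
    \<comment> \<open>Completing the square: at a real root the left side equals the discriminant,
      which must then be zero.\<close>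
    have "(2 * a * x + b)\<^sup>2 = 4 * a * (a * (x\<^sup>2 - y\<^sup>2) + b * x + c) + (b\<^sup>2 - 4 * a * c)"
      using True by (simp add: power2_eq_square algebra_simps)
    hence "(2 * a * x + b)\<^sup>2 \<le> 0" using assms(2) re by simp
    thus ?thesis by simp
  qed (use im in auto)
  hence "b = - (2 * a * x)" by linarith
  with re have "a * (x\<^sup>2 + y\<^sup>2) = c" by (simp add: power2_eq_square algebra_simps)
  thus ?thesis by (simp add: u cmod_def)
qed

section \<open>Eigenvalues of the companion matrix\<close>

text \<open>Inverse of the decoding by \<open>div\<close> and \<open>mod\<close> in
  \<open>block_mat\<close> and \<open>block_vec\<close>.\<close>

definition block_index :: "nat \<Rightarrow> 'p::finite \<Rightarrow> nat" where
  "block_index j q = j * CARD('p) + to_nat_on UNIV q"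

lemma to_nat_on_less_card: "to_nat_on UNIV (q :: 'p::finite) < CARD('p)"
  using to_nat_on_finite[of "UNIV :: 'p set"] by (auto simp: bij_betw_def)

lemma block_index_div [simp]: "block_index j (q :: 'p::finite) div CARD('p) = j"
  and block_index_mod [simp]: "block_index j (q :: 'p::finite) mod CARD('p) = to_nat_on UNIV q"
  using to_nat_on_less_card[of q] by (simp_all add: block_index_def)

lemma block_index_less_iff [simp]:
  "block_index j (q :: 'p::finite) < N * CARD('p) \<longleftrightarrow> j < N"
  by (metis block_index_div less_mult_imp_div_less div_less_iff_less_mult zero_less_card_finite)

lemma bij_betw_block_index:
  "bij_betw (\<lambda>(j, q :: 'p::finite). block_index j q) ({..<N} \<times> UNIV) {..<N * CARD('p)}"
proof (rule bij_betwI[where g = "\<lambda>r. (r div CARD('p), from_nat_into UNIV (r mod CARD('p)))"])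
  show "(\<lambda>(j, q :: 'p). block_index j q) \<in> {..<N} \<times> UNIV \<rightarrow> {..<N * CARD('p)}" by auto
  show "(\<lambda>r. (r div CARD('p), from_nat_into UNIV (r mod CARD('p)) :: 'p))
      \<in> {..<N * CARD('p)} \<rightarrow> {..<N} \<times> UNIV"
    by (auto simp: less_mult_imp_div_less)
next
  fix x :: "nat \<times> 'p"
  show "(\<lambda>r. (r div CARD('p), from_nat_into UNIV (r mod CARD('p)))) (case x of (j, q) \<Rightarrow> block_index j q) = x"
    by (cases x) (simp add: countable_finite)
next
  fix r
  have "r mod CARD('p) \<in> to_nat_on (UNIV :: 'p set) ` UNIV"
    using to_nat_on_finite[of "UNIV :: 'p set"] by (simp add: bij_betw_def)
  thus "(case (r div CARD('p), from_nat_into UNIV (r mod CARD('p))) of (j, q :: 'p) \<Rightarrow> block_index j q) = r"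
    by (simp add: block_index_def)
qed

lemma block_vec_index_block_index:
  "j < N \<Longrightarrow> vec_index (block_vec N v) (block_index j (q :: 'p::finite)) = v j $ q"
  by (simp add: block_vec_def countable_finite)

lemma block_mat_mult_complex_vec:
  fixes B :: "nat \<Rightarrow> nat \<Rightarrow> real ^ 'p ^ 'p" and v :: "complex Matrix.vec"
  assumes "dim_vec v = N * CARD('p)" and "i < N"
  shows "vec_index (map_mat complex_of_real (block_mat N B) *\<^sub>v v) (block_index i q)
       = (\<Sum>j<N. \<Sum>s\<in>UNIV. of_real (B i j $ q $ s) * vec_index v (block_index j s))"
proof -
  let ?p = "CARD('p)"
  let ?g = "\<lambda>c. of_real (B i (c div ?p) $ q $ from_nat_into UNIV (c mod ?p)) * vec_index v c"
  have "vec_index (map_mat complex_of_real (block_mat N B) *\<^sub>v v) (block_index i q)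
      = (\<Sum>c<N * ?p. ?g c)"
    using assms by (simp add: block_mat_def scalar_prod_def lessThan_atLeast0 countable_finite)
  also have "\<dots> = (\<Sum>x\<in>{..<N} \<times> UNIV. ?g (case x of (j, s :: 'p) \<Rightarrow> block_index j s))"
    by (rule sum.reindex_bij_betw[OF bij_betw_block_index, symmetric])
  also have "\<dots> = (\<Sum>x\<in>{..<N} \<times> UNIV. case x of (j, s) \<Rightarrow>
      of_real (B i j $ q $ s) * vec_index v (block_index j s))"
    by (intro sum.cong) (auto simp: countable_finite)
  finally show ?thesis by (simp add: sum.cartesian_product)
qed

text \<open>The shift rows force the blocks of an eigenvector to be w, z w, z^2 w and so on; the
  last row then becomes a polynomial eigenvalue problem for w. Taking w as the first block keeps it
  nonzero even when z = 0.\<close>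

lemma companion_eigenvalueE:
  fixes \<Delta> :: "real ^ 'p ^ 'p"
  assumes "eigenvalue (map_mat complex_of_real (companion k \<alpha> \<beta> \<Delta>)) z"
  obtains w :: "'p \<Rightarrow> complex" and q0 where "w q0 \<noteq> 0"
    and "\<And>q. z ^ (k + 1) * w q
      = (\<Sum>j\<le>k. z ^ (k - j) * (\<Sum>s\<in>UNIV. of_real (lag_coeff k \<alpha> \<beta> \<Delta> j $ q $ s) * w s))"
proof -
  let ?p = "CARD('p)" and ?A = "map_mat complex_of_real (companion k \<alpha> \<beta> \<Delta>)"
  have dim: "dim_row ?A = (k + 1) * ?p" by (simp add: companion_def block_mat_def)
  obtain v where "eigenvector ?A v z" using assms unfolding eigenvalue_def by blast
  hence v: "dim_vec v = (k + 1) * ?p" "v \<noteq> 0\<^sub>v ((k + 1) * ?p)" "?A *\<^sub>v v = z \<cdot>\<^sub>v v"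
    unfolding eigenvector_def dim carrier_vec_def by blast+
  define u where "u j q = vec_index v (block_index j q)" for j and q :: 'p
  let ?B = "\<lambda>i j. if i < k then (if j = i + 1 then Finite_Cartesian_Product.mat 1 else 0)
            else lag_coeff k \<alpha> \<beta> \<Delta> (k - j)"
  have row: "z * u i q = (\<Sum>j<k + 1. \<Sum>s\<in>UNIV. of_real (?B i j $ q $ s) * u j s)"
    if "i < k + 1" for i q
  proof -
    have "block_index i q < dim_vec v" using that unfolding v(1) block_index_less_iff .
    hence "z * u i q = vec_index (z \<cdot>\<^sub>v v) (block_index i q)" by (simp add: u_def)
    also have "\<dots> = vec_index (map_mat of_real (block_mat (k + 1) ?B) *\<^sub>v v) (block_index i q)"
      unfolding v(3)[symmetric] companion_def ..
    also have "\<dots> = (\<Sum>j<k + 1. \<Sum>s\<in>UNIV. of_real (?B i j $ q $ s) * u j s)"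
      unfolding u_def by (rule block_mat_mult_complex_vec[OF v(1) that])
    finally show ?thesis .
  qed
  have shift: "u (i + 1) q = z * u i q" if "i < k" for i q
  proof -
    have "z * u i q = (\<Sum>j<k + 1. \<Sum>s\<in>UNIV. if j = i + 1 then (if q = s then u j s else 0) else 0)"
      unfolding row[OF trans_less_add1[OF that]] using that by (intro sum.cong refl) (simp add: Finite_Cartesian_Product.mat_def)
    also have "\<dots> = (\<Sum>j<k + 1. if j = i + 1 then u j q else 0)"
      by (intro sum.cong) auto
    finally show ?thesis using that by simp
  qed
  have pow: "u i q = z ^ i * u 0 q" if "i \<le> k" for i q
    using that by (induction i) (use shift in auto)
  have "\<exists>q. u 0 q \<noteq> 0"
  proof (rule ccontr)
    assume "\<not> ?thesis"
    hence 0: "u i q = 0" if "i < k + 1" for i q using pow[of i q] that by simp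
    have "v = 0\<^sub>v ((k + 1) * ?p)"
    proof (rule eq_vecI)
      fix r assume "r < dim_vec (0\<^sub>v ((k + 1) * ?p) :: complex Matrix.vec)"
      hence r: "r < (k + 1) * ?p" by simp
      hence "r \<in> (\<lambda>(j, q :: 'p). block_index j q) ` ({..<k + 1} \<times> UNIV)"
        unfolding bij_betw_imp_surj_on[OF bij_betw_block_index] by simp
      then obtain j and q :: 'p where "j < k + 1" "r = block_index j q" by auto
      thus "vec_index v r = vec_index (0\<^sub>v ((k + 1) * ?p)) r"
        using 0[of j q] r by (simp add: u_def)
    qed (simp add: v(1))
    with v(2) show False by simp
  qed
  then obtain q0 where q0: "u 0 q0 \<noteq> 0" by blast
  show ?thesis
  proof (rule that[of "u 0", OF q0])
    fix q
    have "z ^ (k + 1) * u 0 q = z * u k q" using pow[of k q] by simp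
    also have "\<dots> = (\<Sum>j\<le>k. z ^ j * (\<Sum>s\<in>UNIV. of_real (lag_coeff k \<alpha> \<beta> \<Delta> (k - j) $ q $ s) * u 0 s))"
    proof -
      have "(\<Sum>s\<in>UNIV. of_real (?B k j $ q $ s) * u j s)
          = z ^ j * (\<Sum>s\<in>UNIV. of_real (lag_coeff k \<alpha> \<beta> \<Delta> (k - j) $ q $ s) * u 0 s)" if "j \<le> k" for j
        unfolding pow[OF that] sum_distrib_left by (simp add: mult.left_commute)
      thus ?thesis using row[of k q] by (simp add: lessThan_Suc_atMost)
    qed
    also have "\<dots> = (\<Sum>j\<le>k. z ^ (k - j) * (\<Sum>s\<in>UNIV. of_real (lag_coeff k \<alpha> \<beta> \<Delta> j $ q $ s) * u 0 s))"
      by (rule sum.reindex_bij_witness[of _ "\<lambda>j. k - j" "\<lambda>j. k - j"]) auto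
    finally show "z ^ (k + 1) * u 0 q
      = (\<Sum>j\<le>k. z ^ (k - j) * (\<Sum>s\<in>UNIV. of_real (lag_coeff k \<alpha> \<beta> \<Delta> j $ q $ s) * u 0 s))" .
  qed
qed

section \<open>Quadratic forms and Rayleigh quotients\<close>

lemma sandwiched_quadratic_form:
  assumes "\<Delta> \<in> sandwiched m L"
  shows "m * (x \<bullet> x) \<le> x \<bullet> (\<Delta> *v x)" and "x \<bullet> (\<Delta> *v x) \<le> L * (x \<bullet> x)"
  using assms
  by (auto simp: sandwiched_def psd_le_def matrix_vector_mult_diff_rdistrib inner_diff_right
      scaleR_matrix_vector_assoc[symmetric])

lemma sandwiched_symmetric:
  assumes "\<Delta> \<in> sandwiched m L"
  shows "x \<bullet> (\<Delta> *v y) = y \<bullet> (\<Delta> *v x)"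
  using assms dot_lmul_matrix[of x \<Delta> y] transpose_matrix_vector[of \<Delta> x]
  by (simp add: sandwiched_def inner_commute)

text \<open>The number \<open>c\<close> is the Rayleigh quotient of \<open>w\<close>, so that the spectral theorem is not needed.\<close>

lemma sandwiched_pencil_singular:
  fixes \<Delta> :: "real ^ 'p ^ 'p" and w :: "'p \<Rightarrow> complex"
  assumes \<Delta>: "\<Delta> \<in> sandwiched m L" and "w q0 \<noteq> 0"
    and eq: "\<And>q. a * w q + b * (\<Sum>s\<in>UNIV. of_real (\<Delta> $ q $ s) * w s) = 0"
  obtains c where "m \<le> c" and "c \<le> L" and "a + of_real c * b = 0"
proof -
  \<comment> \<open>Real and imaginary parts reduce the Hermitian form of \<Delta> at w to two real
    quadratic forms; the mixed terms cancel by symmetry.\<close>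
  define x :: "real ^ 'p" where "x = (\<chi> q. Re (w q))"
  define y :: "real ^ 'p" where "y = (\<chi> q. Im (w q))"
  define D where "D = x \<bullet> x + y \<bullet> y"
  define R where "R = x \<bullet> (\<Delta> *v x) + y \<bullet> (\<Delta> *v y)"
  have "x $ q0 \<noteq> 0 \<or> y $ q0 \<noteq> 0"
    using \<open>w q0 \<noteq> 0\<close> by (simp add: x_def y_def complex_eq_iff)
  hence "x \<noteq> 0 \<or> y \<noteq> 0" by auto
  hence D: "D > 0" by (auto simp: D_def add_pos_nonneg add_nonneg_pos)
  have R: "m * D \<le> R" "R \<le> L * D"
    using sandwiched_quadratic_form[OF \<Delta>, of x] sandwiched_quadratic_form[OF \<Delta>, of y]
    by (simp_all add: D_def R_def distrib_left)
  have D_sum: "(\<Sum>q\<in>UNIV. cnj (w q) * w q) = of_real D"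
    by (simp add: complex_eq_iff D_def inner_vec_def x_def y_def sum.distrib)
  define S where "S q = (\<Sum>s\<in>UNIV. of_real (\<Delta> $ q $ s) * w s)" for q
  have "(\<Sum>q\<in>UNIV. cnj (w q) * S q)
      = Complex R (x \<bullet> (\<Delta> *v y) - y \<bullet> (\<Delta> *v x))"
    by (simp add: complex_eq_iff R_def S_def inner_vec_def x_def y_def matrix_vector_mult_def
        sum.distrib sum_subtractf)
  also have "\<dots> = of_real R"
    using sandwiched_symmetric[OF \<Delta>, of x y] by (simp add: complex_eq_iff)
  finally have R_sum: "(\<Sum>q\<in>UNIV. cnj (w q) * S q) = of_real R" .
  \<comment> \<open>Pairing the vector equation with w leaves one scalar equation, with c = R /
    D.\<close>
  have "0 = (\<Sum>q\<in>UNIV. cnj (w q) * (a * w q + b * S q))"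
    by (simp add: eq S_def)
  also have "\<dots> = a * (\<Sum>q\<in>UNIV. cnj (w q) * w q)
      + b * (\<Sum>q\<in>UNIV. cnj (w q) * S q)"
    unfolding sum_distrib_left sum.distrib[symmetric]
    by (intro sum.cong) (simp_all only: distrib_left mult.left_commute)
  finally have "a * of_real D + b * of_real R = 0" by (simp only: D_sum R_sum)
  hence "a + of_real (R / D) * b = 0"
    using D by (simp add: field_simps)
  with R D show ?thesis
    by (intro that[of "R / D"]) (simp_all add: field_simps)
qed

section \<open>Powers of a matrix with spectral radius below 1\<close>

lemma eigenvalue_smult_mat:
  fixes A :: "'a::field mat"
  assumes A: "A \<in> carrier_mat N N" and "eigenvalue (c \<cdot>\<^sub>m A) z" and "c \<noteq> 0"
  shows "eigenvalue A (z / c)"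
proof -
  obtain v where "eigenvector (c \<cdot>\<^sub>m A) v z" using assms(2) unfolding eigenvalue_def by blast
  hence v: "v \<in> carrier_vec N" "v \<noteq> 0\<^sub>v N" and Av: "(c \<cdot>\<^sub>m A) *\<^sub>v v = z \<cdot>\<^sub>v v"
    using A by (auto simp: eigenvector_def)
  have "A *\<^sub>v v = (z / c) \<cdot>\<^sub>v v"
  proof (rule eq_vecI)
    fix i assume "i < dim_vec ((z / c) \<cdot>\<^sub>v v)"
    hence i: "i < N" using v(1) by auto
    have "vec_index ((c \<cdot>\<^sub>m A) *\<^sub>v v) i = c * vec_index (A *\<^sub>v v) i"
      using A v(1) i by (auto simp: scalar_prod_def sum_distrib_left mult.assoc intro!: sum.cong)
    thus "vec_index (A *\<^sub>v v) i = vec_index ((z / c) \<cdot>\<^sub>v v) i"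
      using v(1) i assms(3) unfolding Av by (simp add: field_simps)
  qed (use A v in auto)
  with A v show ?thesis unfolding eigenvalue_def eigenvector_def by auto
qed

lemma pow_smult_mat:
  fixes A :: "'a::comm_ring_1 mat"
  assumes "A \<in> carrier_mat N N"
  shows "(c \<cdot>\<^sub>m A) ^\<^sub>m k = c ^ k \<cdot>\<^sub>m (A ^\<^sub>m k)"
proof (induction k)
  case 0
  then show ?case using assms by (auto intro!: eq_matI)
next
  case (Suc k)
  have "A ^\<^sub>m k \<in> carrier_mat N N" using assms by simp
  then show ?case
    using assms Suc
    by (simp add: mult_smult_assoc_mat[of _ N N] mult_smult_distrib[of _ N N])
      (auto intro!: eq_matI simp: mult_ac)
qed

text \<open>Choose r strictly between the spectral radius and 1. Then A / r still has spectral
  radius below 1, so its powers have bounded entries, and the entries of A^k are at most a constant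
  times r^k.\<close>

lemma power_mult_vec_tendsto_0:
  fixes A :: "complex mat"
  assumes A: "A \<in> carrier_mat N N" and "spectral_radius A < 1"
    and v: "v \<in> carrier_vec N" and i: "i < N"
  shows "(\<lambda>k. vec_index (A ^\<^sub>m k *\<^sub>v v) i) \<longlonglongrightarrow> 0"
proof -
  have N: "N > 0" using i by simp
  have "spectral_radius A \<ge> 0"
    using spectral_radius_mem_max(1)[OF A N] by auto
  then obtain r where r: "spectral_radius A < r" "r < 1" "0 < r"
    using dense[OF assms(2)] by (meson le_less_trans)
  let ?A = "inverse (of_real r) \<cdot>\<^sub>m A"
  have A': "?A \<in> carrier_mat N N" using A by simp
  from spectral_radius_mem_max(1)[OF A' N] obtain z
    where z: "eigenvalue ?A z" and sr: "spectral_radius ?A = cmod z"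
    by (auto simp: spectrum_def)
  have "eigenvalue A (z / inverse (of_real r))"
    using eigenvalue_smult_mat[OF A z] r by simp
  hence "cmod (z / inverse (of_real r)) \<le> spectral_radius A"
    using spectral_radius_mem_max(2)[OF A N] by (auto simp: spectrum_def)
  moreover have "z / inverse (of_real r) = z * of_real r" by (simp add: divide_inverse)
  ultimately have "cmod z * r \<le> spectral_radius A" using r by (simp add: norm_mult)
  hence "cmod z * r < 1 * r" using r(1) by linarith
  hence "spectral_radius ?A < 1" using r(3) sr by (simp only: mult_less_cancel_right_pos)
  from spectral_radius_jnf_norm_bound_less_1_upper_triangular[OF A' this]
  obtain c where c: "\<And>k. norm_bound (?A ^\<^sub>m k) c" by blast
  have entry: "cmod ((A ^\<^sub>m k) $$ (i, j)) \<le> c * r ^ k" if "j < N" for k j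
  proof -
    have "cmod ((?A ^\<^sub>m k) $$ (i, j)) \<le> c"
      using c[of k] carrier_matD[OF pow_carrier_mat[OF A', of k]] i that
      unfolding norm_bound_def by metis
    moreover have "(?A ^\<^sub>m k) $$ (i, j) = inverse (of_real r) ^ k * (A ^\<^sub>m k) $$ (i, j)"
      unfolding pow_smult_mat[OF A] using A i that by simp
    ultimately have "inverse r ^ k * cmod ((A ^\<^sub>m k) $$ (i, j)) \<le> c"
      using r(3) by (simp only: norm_mult norm_power norm_inverse norm_of_real abs_of_pos)
    thus ?thesis using r(3) by (simp add: field_simps)
  qed
  have bound: "cmod (vec_index (A ^\<^sub>m k *\<^sub>v v) i) \<le> (\<Sum>j<N. c * cmod (vec_index v j)) * r ^ k" for k
  proof -
    have "vec_index (A ^\<^sub>m k *\<^sub>v v) i = (\<Sum>j<N. (A ^\<^sub>m k) $$ (i, j) * vec_index v j)"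
      using A v i by (simp add: scalar_prod_def lessThan_atLeast0)
    also have "cmod \<dots> \<le> (\<Sum>j<N. c * r ^ k * cmod (vec_index v j))"
      by (intro sum_norm_le) (simp add: norm_mult entry mult_right_mono)
    finally show ?thesis unfolding sum_distrib_right by (simp only: mult_ac)
  qed
  have "(\<lambda>k. (\<Sum>j<N. c * cmod (vec_index v j)) * r ^ k) \<longlonglongrightarrow> 0"
    using r by (intro tendsto_mult_right_zero LIMSEQ_power_zero) simp
  thus ?thesis
    by (rule Lim_null_comparison[rotated]) (simp add: bound)
qed

lemma recursion_linear_tendsto_0:
  fixes x :: "nat \<Rightarrow> real ^ 'p"
  assumes rec: "recursion k \<alpha> \<beta> (\<lambda>y s. \<Delta> *v y) x"
    and sr: "spectral_radius (map_mat complex_of_real (companion k \<alpha> \<beta> \<Delta>)) < 1"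
  shows "x \<longlonglongrightarrow> 0"
proof -
  let ?p = "CARD('p)" and ?M = "companion k \<alpha> \<beta> \<Delta>"
  let ?A = "map_mat complex_of_real ?M"
  define N where "N = (k + 1) * ?p"
  \<comment> \<open>The window starts at time t, so \<open>companion_step\<close> is applied at time
    t + k, and block 0 of \<open>X t\<close> is \<open>x t\<close>.\<close>
  define X where "X t = block_vec (k + 1) (\<lambda>i. x (t + i))" for t
  have M: "?M \<in> carrier_mat N N" by (simp add: companion_def block_mat_def N_def)
  have X: "X t \<in> carrier_vec N" for t by (auto simp: X_def block_vec_def N_def)
  have step: "?M *\<^sub>v X t = X (t + 1)" for t
    using companion_step[OF rec, of "t + k"] by (simp add: X_def)
  have pow: "X (t + s) = ?M ^\<^sub>m t *\<^sub>v X s" for t s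
  proof (induction t arbitrary: s)
    case 0
    then show ?case using X[of s] carrier_matD(1)[OF M] by simp
  next
    case (Suc t)
    have "X (Suc t + s) = ?M ^\<^sub>m t *\<^sub>v (?M *\<^sub>v X s)"
      using Suc[of "s + 1"] by (simp add: step)
    also have "\<dots> = (?M ^\<^sub>m t * ?M) *\<^sub>v X s"
      by (rule assoc_mult_mat_vec[OF pow_carrier_mat[OF M] M X, symmetric])
    finally show ?case by simp
  qed
  have component: "(\<lambda>t. vec_index (X t) i) \<longlonglongrightarrow> 0" if "i < N" for i
  proof -
    let ?v = "map_vec complex_of_real (X 0)"
    have A: "?A \<in> carrier_mat N N" and v: "?v \<in> carrier_vec N" using M X[of 0] by simp_all
    have "map_vec complex_of_real (X t) = ?A ^\<^sub>m t *\<^sub>v ?v" for t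
      using pow[of t 0] of_real_hom.mult_mat_vec_hom[OF pow_carrier_mat[OF M] X[of 0], of t]
      by (simp add: of_real_hom.mat_hom_pow[OF M])
    hence "vec_index (?A ^\<^sub>m t *\<^sub>v ?v) i = of_real (vec_index (X t) i)" for t
      using X[of t] that by (metis carrier_vecD index_map_vec(1))
    with power_mult_vec_tendsto_0[OF A sr v that]
    have "(\<lambda>t. complex_of_real (vec_index (X t) i)) \<longlonglongrightarrow> of_real 0" by simp
    thus ?thesis unfolding tendsto_of_real_iff .
  qed
  have "(\<lambda>t. x t $ q) \<longlonglongrightarrow> 0 $ q" for q
  proof -
    have "block_index 0 q < N" unfolding N_def block_index_less_iff by simp
    from component[OF this] show ?thesis
      unfolding X_def by (simp add: block_vec_index_block_index)
  qed
  thus ?thesis by (rule vec_tendstoI)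
qed

section \<open>The optimal parameters\<close>

lemma gradient_eq:
  assumes "GDERIV g x :> D"
  shows "gradient g x = D"
  unfolding gradient_def
proof (rule the_equality[where P = "\<lambda>D. GDERIV g x :> D", OF assms])
  fix D' assume "GDERIV g x :> D'"
  hence "(\<lambda>h. h \<bullet> D') = (\<lambda>h. h \<bullet> D)"
    using assms unfolding gderiv_def by (rule has_derivative_unique)
  thus "D' = D" by (metis vector_eq_ldot)
qed

lemma gradient_quadratic:
  fixes \<Delta> :: "real ^ 'p ^ 'p"
  assumes "\<Delta> \<in> sandwiched m L"
  shows "gradient (\<lambda>z. 1/2 * ((z - p) \<bullet> (\<Delta> *v (z - p))) + c) x = \<Delta> *v (x - p)"
proof (rule gradient_eq)
  have 1: "((\<lambda>z. z - p) has_derivative (\<lambda>h. h)) (at x)"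
    by (auto intro!: derivative_eq_intros)
  have 2: "((\<lambda>z. \<Delta> *v (z - p)) has_derivative (\<lambda>h. \<Delta> *v h)) (at x)"
    by (rule bounded_linear.has_derivative[OF matrix_vector_mul_bounded_linear 1])
  \<comment> \<open>Symmetry of \<Delta> merges the two terms of the product rule and absorbs the
    factor 1/2.\<close>
  have "(\<lambda>h. 1/2 * ((x - p) \<bullet> (\<Delta> *v h) + h \<bullet> (\<Delta> *v (x - p))) + 0) = (\<lambda>h. h \<bullet> (\<Delta> *v (x - p)))"
  proof
    fix h
    show "1/2 * ((x - p) \<bullet> (\<Delta> *v h) + h \<bullet> (\<Delta> *v (x - p))) + 0 = h \<bullet> (\<Delta> *v (x - p))"
      unfolding sandwiched_symmetric[OF assms, of "x - p" h] by simp
  qed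
  with has_derivative_add[OF has_derivative_mult_right[OF has_derivative_inner[OF 1 2], of "1/2"]
      has_derivative_const[of c]]
  show "GDERIV (\<lambda>z. 1/2 * ((z - p) \<bullet> (\<Delta> *v (z - p))) + c) x :> \<Delta> *v (x - p)"
    unfolding gderiv_def by (simp only:)
qed

section \<open>Parameters as coefficients of polynomials in the lag\<close>

lemma coeff_linear_power: "coeff ([:1, c:] ^ n) i = of_nat (n choose i) * c ^ i"
  using degree_linear_power_le[of 1 c n]
  by (cases "i \<le> n") (simp_all add: coeff_linear_poly_power coeff_eq_0 binomial_eq_0)

lemma coeff_linear_powers:
  fixes c d :: "'a::{comm_semiring_1,semiring_no_zero_divisors}"
  shows "coeff ([:1, c:] ^ k * [:1, d:] ^ l) j
       = (\<Sum>i=0..j. of_nat (k choose i) * of_nat (l choose (j - i)) * c ^ i * d ^ (j - i))"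
  by (simp add: coeff_mult coeff_linear_power atMost_atLeast0 mult_ac)

text \<open>The momentum terms are weighted differences, hence the factor 1 - x of p. Indices shift
  by one because coefficient 0 belongs to x(t+1). At j = k the missing \<beta> term agrees with
  \<open>coeff b (k + 1) = 0\<close>, which is the degree bound.\<close>

lemma lag_coeff_eq_coeff:
  fixes p q b :: "real poly"
  assumes p: "p = [:1, -1:] * b" and "coeff b 0 = 1" and "degree b \<le> k"
    and \<beta>: "\<And>j. \<beta> j = - coeff b (j + 1)" and \<alpha>: "\<And>j. \<alpha> j = coeff q (j + 1)" and "j \<le> k"
  shows "lag_coeff k \<alpha> \<beta> \<Delta> j
       = - (coeff p (j + 1) *\<^sub>R Finite_Cartesian_Product.mat 1 + coeff q (j + 1) *\<^sub>R \<Delta>)"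
proof -
  have "(if j = 0 then 1 else 0) + (if j < k then \<beta> j else 0) - (if 0 < j then \<beta> (j - 1) else 0)
      = - coeff p (j + 1)"
    using assms(2,3,6) by (cases j) (auto simp: \<beta> p coeff_eq_0)
  thus ?thesis by (simp add: lag_coeff_def \<alpha>)
qed

text \<open>Setting \<Delta> = 0 isolates the momentum part, whose lag weights are the coefficients
  of p; the n-fold zero of p at 1 annihilates the trajectory.\<close>

lemma trajectory_recursion:
  fixes a :: "nat \<Rightarrow> real ^ 'p"
  assumes lag: "\<And>j. j \<le> k \<Longrightarrow> lag_coeff k \<alpha> \<beta> (0 :: real ^ 'p ^ 'p) j
      = - (coeff p (j + 1) *\<^sub>R Finite_Cartesian_Product.mat 1)"
    and "[:1, -1:] ^ n dvd p" and "degree p \<le> k + 1" and "coeff p 0 = 1" and "k \<le> t"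
    and xs: "\<And>t. xs t = (\<Sum>i<n. (real t ^ i) *\<^sub>R a i)"
  shows "xs (t + 1) = xs t + (\<Sum>j<k. \<beta> j *\<^sub>R (xs (t - j) - xs (t - j - 1)))"
proof -
  have "0 = (\<Sum>i\<le>k + 1. coeff p i *\<^sub>R xs (t + 1 - i))"
    unfolding xs using assms by (intro sum_coeff_scaleR_trajectory_eq_0[symmetric]) auto
  also have "\<dots> = xs (t + 1) + (\<Sum>j\<le>k. coeff p (j + 1) *\<^sub>R xs (t - j))"
    using assms(4) by (simp add: sum.atMost_Suc_shift del: sum.atMost_Suc)
  also have "(\<Sum>j\<le>k. coeff p (j + 1) *\<^sub>R xs (t - j)) = - (\<Sum>j\<le>k. lag_coeff k \<alpha> \<beta> 0 j *v xs (t - j))"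
    unfolding sum_negf[symmetric]
    by (intro sum.cong)
      (simp_all add: lag scaleR_matrix_vector_assoc[symmetric] flip: scaleR_minus_left)
  also have "(\<Sum>j\<le>k. lag_coeff k \<alpha> \<beta> 0 j *v xs (t - j))
      = xs t + (\<Sum>j<k. \<beta> j *\<^sub>R (xs (t - j) - xs (t - j - 1)))"
    unfolding sum_lag_coeff by simp
  finally have "xs (t + 1) = - (- (xs t + (\<Sum>j<k. \<beta> j *\<^sub>R (xs (t - j) - xs (t - j - 1)))))"
    by (rule eq_neg_iff_add_eq_0[THEN iffD2, OF sym])
  thus ?thesis by (simp only: minus_minus)
qed

text \<open>The reversal of A B, with ascending powers counting lags. For n >= 1,
  \<open>momentum_poly\<close> drops one factor 1 - x, and \<open>gradient_poly\<close> reverses K1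
  A^2 + K2 B^2 - K3 A B.\<close>

definition lag_poly :: "nat \<Rightarrow> real \<Rightarrow> real poly" where
  "lag_poly n r = [:1, - r\<^sup>2:] ^ n * [:1, -1:] ^ n"

definition momentum_poly :: "nat \<Rightarrow> real \<Rightarrow> real poly" where
  "momentum_poly n r = [:1, - r\<^sup>2:] ^ n * [:1, -1:] ^ (n - 1)"

definition gradient_poly :: "nat \<Rightarrow> real \<Rightarrow> real \<Rightarrow> real poly" where
  "gradient_poly n m L =
     Polynomial.smult (K1 m L) ([:1, - (rho n m L)\<^sup>2:] ^ (2 * n))
     + Polynomial.smult (K2 m L) ([:1, -1:] ^ (2 * n))
     - Polynomial.smult (K3 m L) (lag_poly n (rho n m L))"

lemma beta_opt_eq_coeff: "beta_opt n m L j = - coeff (momentum_poly n (rho n m L)) (j + 1)"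
  unfolding beta_opt_def momentum_poly_def coeff_linear_powers by simp

lemma alpha_opt_eq_coeff: "alpha_opt n m L j = coeff (gradient_poly n m L) (j + 1)"
  unfolding alpha_opt_def gradient_poly_def lag_poly_def coeff_add coeff_diff coeff_smult
    coeff_linear_powers coeff_linear_power by (simp add: mult_ac)

lemma rev_eval_Suc:
  "rev_eval (Suc k) p z
     = of_real (coeff p 0) * z ^ (k + 1) + (\<Sum>j\<le>k. of_real (coeff p (j + 1)) * z ^ (k - j))"
  unfolding rev_eval_def sum.atMost_Suc_shift by simp

section \<open>Characteristic roots, rate and convergence for the optimal parameters\<close>

context
  fixes n :: nat and m L :: real
  assumes n: "n \<ge> 1" and m: "0 < m" and mL: "m < L"
begin

lemma sqrt_sum_pos: "0 < sqrt L + sqrt m"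
  using m mL by (simp add: add_pos_pos)

lemma rho_power: "rho n m L ^ n = (sqrt L - sqrt m) / (sqrt L + sqrt m)"
proof -
  have "(x powr (1 / real n)) ^ n = x" if "x > 0" for x :: real
    using that n by (simp add: powr_power)
  moreover have "(sqrt L - sqrt m) / (sqrt L + sqrt m) > 0"
    using mL sqrt_sum_pos by simp
  ultimately show ?thesis unfolding rho_def by blast
qed

lemma rho_pos: "0 < rho n m L"
  using mL sqrt_sum_pos unfolding rho_def by simp

lemma rho_less_1: "rho n m L < 1"
proof (rule ccontr)
  assume "\<not> ?thesis"
  hence "1 \<le> rho n m L ^ n" by (simp add: one_le_power)
  moreover have "(sqrt L - sqrt m) / (sqrt L + sqrt m) < 1"
    using m sqrt_sum_pos by simp
  ultimately show False by (simp add: rho_power)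
qed

lemma K1_pos: "0 < K1 m L"
  using m mL sqrt_sum_pos by (simp add: K1_def)

text \<open>Makes coefficient 0 of \<open>gradient_poly\<close> vanish: no gradient at time t + 1
  enters, so the recursion is explicit.\<close>

lemma K3_eq: "K3 m L = K1 m L + K2 m L"
  using m mL by (simp add: K1_def K2_def K3_def power2_eq_square field_simps)

text \<open>K2 / K1 is the product of the two roots A / B, which fixes their modulus.\<close>

lemma K2_eq: "K2 m L = K1 m L * (rho n m L ^ n)\<^sup>2"
  using sqrt_sum_pos unfolding rho_power by (simp add: K1_def K2_def power_divide)

text \<open>K3 is the mean of 1/m and 1/L, and 2 sqrt (K1 K2) is half their difference. The
  discriminant is thus a difference of squares, equal to (1 - c/m) (1 - c/L).\<close>

lemma discriminant_nonpos:
  assumes "m \<le> c" and "c \<le> L"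
  shows "(1 - c * K3 m L)\<^sup>2 \<le> 4 * (c * K1 m L) * (c * K2 m L)"
proof -
  have "(sqrt L + sqrt m) * (sqrt L - sqrt m) = L - m"
    using m mL by (simp add: algebra_simps)
  hence "K1 m L * K2 m L = (L - m)\<^sup>2 / (4 * L * m)\<^sup>2"
    unfolding K1_def K2_def by (simp add: power2_eq_square[of "4 * L * m"] flip: power_mult_distrib)
  moreover have "4 * (c * K1 m L) * (c * K2 m L) = 4 * c\<^sup>2 * (K1 m L * K2 m L)"
    by (simp add: power2_eq_square)
  ultimately have "(1 - c * K3 m L)\<^sup>2 - 4 * (c * K1 m L) * (c * K2 m L)
      = (1 - c * ((L + m) / (2 * L * m)))\<^sup>2 - 4 * c\<^sup>2 * ((L - m)\<^sup>2 / (4 * L * m)\<^sup>2)"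
    by (simp only: K3_def)
  also have "\<dots> = (m - c) * (L - c) / (L * m)"
    using m mL by (simp add: power2_eq_square field_simps)
  also have "\<dots> \<le> 0"
    using assms m mL by (intro divide_nonpos_pos mult_nonpos_nonneg) auto
  finally show ?thesis by simp
qed

lemma rev_eval_lag_poly:
  "rev_eval (2 * n) (lag_poly n (rho n m L)) z = (z - of_real ((rho n m L)\<^sup>2)) ^ n * (z - 1) ^ n"
  using rev_eval_linear_powers[of n n "- (rho n m L)\<^sup>2" "-1" z]
  by (simp add: lag_poly_def mult_2)

lemma rev_eval_gradient_poly:
  "rev_eval (2 * n) (gradient_poly n m L) z =
     of_real (K1 m L) * ((z - of_real ((rho n m L)\<^sup>2)) ^ n)\<^sup>2 + of_real (K2 m L) * ((z - 1) ^ n)\<^sup>2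
     - of_real (K3 m L) * ((z - of_real ((rho n m L)\<^sup>2)) ^ n * (z - 1) ^ n)"
proof -
  have "rev_eval (2 * n) ([:1, c:] ^ (2 * n)) z = ((z + of_real c) ^ n)\<^sup>2" for c
    using rev_eval_linear_powers[of "2 * n" 0 c 0 z]
    by (simp add: power_mult[symmetric] mult.commute)
  thus ?thesis
    by (simp add: gradient_poly_def rev_eval_add rev_eval_diff rev_eval_smult rev_eval_lag_poly)
qed

text \<open>The factor c cancels from the product of the roots, which is why the modulus is the same
  for all c in [m, L].\<close>

lemma root_modulus:
  assumes c: "m \<le> c" "c \<le> L"
    and root: "rev_eval (2 * n) (lag_poly n (rho n m L)) z
      + of_real c * rev_eval (2 * n) (gradient_poly n m L) z = 0"
  shows "cmod z = rho n m L"
proof -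
  let ?r = "rho n m L"
  define A where "A = (z - of_real (?r\<^sup>2)) ^ n"
  define B where "B = (z - 1) ^ n"
  have eq: "of_real (c * K1 m L) * A\<^sup>2 + of_real (1 - c * K3 m L) * A * B + of_real (c * K2 m L) * B\<^sup>2 = 0"
    using root unfolding rev_eval_lag_poly rev_eval_gradient_poly A_def[symmetric] B_def[symmetric]
    by (simp add: algebra_simps)
  have r: "0 < ?r" "?r < 1" by (rule rho_pos rho_less_1)+
  hence r2: "?r\<^sup>2 < 1" by (simp add: power_less_one_iff)
  \<comment> \<open>Justifies dividing by B: at z = 1 only c K1 A^2 would remain, with A = (1 -
    \<rho>^2)^n nonzero.\<close>
  have "z \<noteq> 1"
  proof
    assume "z = 1"
    hence B: "B = 0" using n by (simp add: B_def)
    have "A = of_real ((1 - ?r\<^sup>2) ^ n)" using \<open>z = 1\<close> by (simp add: A_def)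
    moreover have "(1 - ?r\<^sup>2) ^ n \<noteq> 0" using r2 by simp
    ultimately have "A \<noteq> 0" by (simp only: of_real_eq_0_iff not_False_eq_True)
    with eq m c K1_pos show False by (simp add: B)
  qed
  hence B: "B \<noteq> 0" by (simp add: B_def)
  have "of_real (c * K1 m L) * (A / B)\<^sup>2 + of_real (1 - c * K3 m L) * (A / B) + of_real (c * K2 m L)
      = (of_real (c * K1 m L) * A\<^sup>2 + of_real (1 - c * K3 m L) * A * B + of_real (c * K2 m L) * B\<^sup>2) / B\<^sup>2"
    using B by (simp add: field_simps power2_eq_square)
  also have "\<dots> = 0" unfolding eq by simp
  finally have "c * K1 m L * (cmod (A / B))\<^sup>2 = c * K2 m L"
    using m c K1_pos discriminant_nonpos[OF c] by (intro root_modulus_quadratic) auto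
  hence "(cmod (A / B))\<^sup>2 = (?r ^ n)\<^sup>2"
    using m c K1_pos by (simp add: K2_eq)
  hence "cmod (A / B) = ?r ^ n" using r by (simp add: power2_eq_iff_nonneg)
  hence "cmod A = (?r * cmod (z - 1)) ^ n"
    using B by (simp add: norm_divide field_simps power_mult_distrib) (simp add: B_def norm_power)
  hence "cmod (z - of_real (?r\<^sup>2)) ^ n = (?r * cmod (z - 1)) ^ n"
    by (simp only: A_def norm_power)
  hence "cmod (z - of_real (?r\<^sup>2)) = ?r * cmod (z - 1)"
    by (rule power_eq_imp_eq_base) (use n r in auto)
  hence "(cmod (z - of_real (?r\<^sup>2)))\<^sup>2 = ?r\<^sup>2 * (cmod (z - 1))\<^sup>2"
    by (simp only: power_mult_distrib)
  \<comment> \<open>The terms in Re z cancel because the centre \<open>?r\<^sup>2\<close> is also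
    the squared ratio.\<close>
  hence "(1 - ?r\<^sup>2) * ((cmod z)\<^sup>2 - ?r\<^sup>2) = 0"
    unfolding cmod_power2 by (simp add: power2_eq_square algebra_simps)
  hence "(cmod z)\<^sup>2 = ?r\<^sup>2" using r2 by simp
  thus ?thesis using r by (simp add: power2_eq_iff_nonneg)
qed

lemma lag_coeff_opt:
  assumes "j \<le> 2 * n - 1"
  shows "lag_coeff (2 * n - 1) (alpha_opt n m L) (beta_opt n m L) \<Delta> j
       = - (coeff (lag_poly n (rho n m L)) (j + 1) *\<^sub>R Finite_Cartesian_Product.mat 1
            + coeff (gradient_poly n m L) (j + 1) *\<^sub>R \<Delta>)"
proof (rule lag_coeff_eq_coeff[OF _ _ _ beta_opt_eq_coeff alpha_opt_eq_coeff assms])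
  have "[:1, -1:] ^ n = [:1, -1:] * [:1, -1 :: real:] ^ (n - 1)"
    by (rule trans[OF power_minus_mult[symmetric] mult.commute]) (use n in simp)
  thus "lag_poly n (rho n m L) = [:1, -1:] * momentum_poly n (rho n m L)"
    unfolding lag_poly_def momentum_poly_def by (simp only: mult.left_commute)
  show "coeff (momentum_poly n (rho n m L)) 0 = 1"
    unfolding momentum_poly_def coeff_linear_powers by simp
  have "degree (momentum_poly n (rho n m L)) \<le> n + (n - 1)"
    unfolding momentum_poly_def
    by (rule order_trans[OF degree_mult_le]) (intro add_mono degree_linear_power_le)
  thus "degree (momentum_poly n (rho n m L)) \<le> 2 * n - 1" using n by simp
qed

lemma eigenvalue_companion_opt:
  fixes \<Delta> :: "real ^ 'p ^ 'p"
  assumes \<Delta>: "\<Delta> \<in> sandwiched m L"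
    and "eigenvalue (map_mat complex_of_real
      (companion (2 * n - 1) (alpha_opt n m L) (beta_opt n m L) \<Delta>)) z"
  shows "cmod z = rho n m L"
proof -
  let ?P = "lag_poly n (rho n m L)" and ?Q = "gradient_poly n m L" and ?k = "2 * n - 1"
  have k: "2 * n = Suc ?k" using n by simp
  from companion_eigenvalueE[OF assms(2)] obtain w :: "'p \<Rightarrow> complex" and q0 where w: "w q0 \<noteq> 0"
    and eig: "\<And>q. z ^ (?k + 1) * w q = (\<Sum>j\<le>?k. z ^ (?k - j) *
      (\<Sum>s\<in>UNIV. of_real (lag_coeff ?k (alpha_opt n m L) (beta_opt n m L) \<Delta> j $ q $ s) * w s))"
    by blast
  define S where "S q = (\<Sum>s\<in>UNIV. of_real (\<Delta> $ q $ s) * w s)" for q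
  have lag: "(\<Sum>s\<in>UNIV. of_real (lag_coeff ?k (alpha_opt n m L) (beta_opt n m L) \<Delta> j $ q $ s) * w s)
      = - (of_real (coeff ?P (j + 1)) * w q + of_real (coeff ?Q (j + 1)) * S q)" if "j \<le> ?k" for j q
  proof -
    have "of_real (lag_coeff ?k (alpha_opt n m L) (beta_opt n m L) \<Delta> j $ q $ s) * w s
        = - ((if s = q then of_real (coeff ?P (j + 1)) * w s else 0)
             + of_real (coeff ?Q (j + 1)) * (of_real (\<Delta> $ q $ s) * w s))" for s
      unfolding lag_coeff_opt[OF that] by (simp add: Finite_Cartesian_Product.mat_def algebra_simps)
    thus ?thesis by (simp add: S_def sum_negf sum_subtractf sum.distrib sum_distrib_left)
  qed
  have P0: "coeff ?P 0 = 1" unfolding lag_poly_def coeff_linear_powers by simp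
  \<comment> \<open>With leading coefficients 1 and 0, the term \<open>z ^ (?k + 1) * w q\<close>
    completes the sums over lags to the full reversed polynomials.\<close>
  have Q0: "coeff ?Q 0 = 0"
    unfolding gradient_poly_def coeff_add coeff_diff coeff_smult coeff_linear_power P0
    by (simp add: K3_eq)
  note rev = rev_eval_Suc[of ?k, folded k]
  have "rev_eval (2 * n) ?P z * w q + rev_eval (2 * n) ?Q z * S q = 0" for q
  proof -
    have "z ^ (?k + 1) * w q
        = (\<Sum>j\<le>?k. z ^ (?k - j) * - (of_real (coeff ?P (j + 1)) * w q + of_real (coeff ?Q (j + 1)) * S q))"
      unfolding eig by (intro sum.cong refl) (simp only: lag atMost_iff)
    also have "\<dots> = - ((\<Sum>j\<le>?k. of_real (coeff ?P (j + 1)) * z ^ (?k - j)) * w q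
        + (\<Sum>j\<le>?k. of_real (coeff ?Q (j + 1)) * z ^ (?k - j)) * S q)"
      unfolding sum_distrib_right sum_negf[symmetric] sum.distrib[symmetric]
      by (intro sum.cong refl) (simp add: algebra_simps)
    finally show ?thesis unfolding rev P0 Q0 by (simp add: algebra_simps)
  qed
  from sandwiched_pencil_singular[where w = w, OF \<Delta> w this[unfolded S_def]]
  obtain c where "m \<le> c" "c \<le> L"
    "rev_eval (2 * n) ?P z + of_real c * rev_eval (2 * n) ?Q z = 0" by blast
  thus ?thesis by (rule root_modulus)
qed

lemma spectral_radius_companion_opt:
  fixes \<Delta> :: "real ^ 'p ^ 'p"
  assumes "\<Delta> \<in> sandwiched m L"
  shows "spectral_radius (map_mat complex_of_real
      (companion (2 * n - 1) (alpha_opt n m L) (beta_opt n m L) \<Delta>)) = rho n m L"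
proof -
  let ?A = "map_mat complex_of_real (companion (2 * n - 1) (alpha_opt n m L) (beta_opt n m L) \<Delta>)"
  have "?A \<in> carrier_mat ((2 * n - 1 + 1) * CARD('p)) ((2 * n - 1 + 1) * CARD('p))"
    by (simp add: companion_def block_mat_def)
  from spectral_radius_mem_max(1)[OF this]
  have "spectral_radius ?A \<in> cmod ` spectrum ?A" by simp
  thus ?thesis using eigenvalue_companion_opt[OF assms] by (auto simp: spectrum_def)
qed

lemma conv_rate_opt:
  "conv_rate TYPE('p::finite) (2 * n - 1) (alpha_opt n m L) (beta_opt n m L) m L = rho n m L"
proof -
  \<comment> \<open>The spectral radius is constant on the set, so the supremum only needs a witness
    that the set is nonempty.\<close>
  let ?M = "m *\<^sub>R Finite_Cartesian_Product.mat 1 :: real ^ 'p ^ 'p"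
  have "transpose ?M = ?M"
    by (simp add: transpose_def Finite_Cartesian_Product.mat_def vec_eq_iff)
  hence "?M \<in> sandwiched m L"
    using mL by (simp add: sandwiched_def psd_le_def matrix_vector_mult_diff_rdistrib
        scaleR_matrix_vector_assoc[symmetric] inner_diff_right mult_right_mono)
  hence "(sandwiched m L :: (real ^ 'p ^ 'p) set) \<noteq> {}" by blast
  thus ?thesis unfolding conv_rate_def
    by (simp add: spectral_radius_companion_opt cong: SUP_cong_simp del: One_nat_def)
qed

text \<open>The sum is the value of the gradient polynomial at 1, where B = 0 leaves only K1
  A^2.\<close>

lemma sum_alpha_opt_neq_0: "(\<Sum>j\<le>2 * n - 1. alpha_opt n m L j) \<noteq> 0"
proof -
  let ?Q = "gradient_poly n m L"
  have Q0: "coeff ?Q 0 = 0"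
    unfolding gradient_poly_def lag_poly_def coeff_add coeff_diff coeff_smult coeff_linear_power
      coeff_linear_powers
    by (simp add: K3_eq)
  have "2 * n = Suc (2 * n - 1)" using n by simp
  from rev_eval_Suc[of "2 * n - 1" ?Q 1, folded this]
  have Q: "rev_eval (2 * n) ?Q 1 = of_real (\<Sum>j\<le>2 * n - 1. alpha_opt n m L j)"
    by (simp add: Q0 alpha_opt_eq_coeff)
  have "rev_eval (2 * n) ?Q 1 = of_real (K1 m L * ((1 - (rho n m L)\<^sup>2) ^ n)\<^sup>2)"
    unfolding rev_eval_gradient_poly using n by (simp add: power_0_left)
  hence "(\<Sum>j\<le>2 * n - 1. alpha_opt n m L j) = K1 m L * ((1 - (rho n m L)\<^sup>2) ^ n)\<^sup>2"
    unfolding Q of_real_eq_iff .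
  moreover have "(rho n m L)\<^sup>2 < 1"
    using rho_pos rho_less_1 by (simp add: power_less_one_iff)
  ultimately show ?thesis using K1_pos by simp
qed

lemma globally_convergent_opt:
  fixes f :: "real ^ 'p \<Rightarrow> nat \<Rightarrow> real"
  assumes "quad_cost n m L xs f"
  shows "globally_convergent (2 * n - 1) (alpha_opt n m L) (beta_opt n m L) f xs"
  unfolding globally_convergent_def
proof (intro allI impI)
  let ?k = "2 * n - 1"
  fix x
  assume rec: "recursion ?k (alpha_opt n m L) (beta_opt n m L)
    (\<lambda>y s. gradient (\<lambda>z. f z s) y) x"
  from assms obtain \<Delta> a c where \<Delta>: "\<Delta> \<in> sandwiched m L"
    and xs: "xs = (\<lambda>t. \<Sum>i<n. (real t ^ i) *\<^sub>R a i)"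
    and f: "f = (\<lambda>x t. 1/2 * ((x - xs t) \<bullet> (\<Delta> *v (x - xs t))) + c (xs t))"
    unfolding quad_cost_def by blast
  have grad: "gradient (\<lambda>z. f z s) y = \<Delta> *v (y - xs s)" for y s
    unfolding f by (rule gradient_quadratic[OF \<Delta>])
  have "degree (lag_poly n (rho n m L)) \<le> n + n"
    unfolding lag_poly_def
    by (rule order_trans[OF degree_mult_le]) (intro add_mono degree_linear_power_le)
  hence deg: "degree (lag_poly n (rho n m L)) \<le> ?k + 1" using n by simp
  \<comment> \<open>The gradient vanishes along \<open>xs\<close>, so the trajectory itself solves
    the recursion; subtracting it leaves the homogeneous recursion for the error.\<close>
  have traj: "xs (t + 1) = xs t + (\<Sum>j<?k. beta_opt n m L j *\<^sub>R (xs (t - j) - xs (t - j - 1)))"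
    if "?k \<le> t" for t
  proof (rule trajectory_recursion[OF _ _ deg _ that])
    show "lag_coeff ?k (alpha_opt n m L) (beta_opt n m L) 0 j
        = - (coeff (lag_poly n (rho n m L)) (j + 1) *\<^sub>R Finite_Cartesian_Product.mat 1)" if "j \<le> ?k" for j
      using lag_coeff_opt[OF that, of 0] by simp
    show "[:1, -1:] ^ n dvd lag_poly n (rho n m L)"
      unfolding lag_poly_def by (rule dvd_triv_right)
    show "coeff (lag_poly n (rho n m L)) 0 = 1"
      unfolding lag_poly_def coeff_linear_powers by simp
  qed (simp add: xs)
  have "recursion ?k (alpha_opt n m L) (beta_opt n m L) (\<lambda>y s. \<Delta> *v y) (\<lambda>t. x t - xs t)"
    unfolding recursion_def
  proof (intro allI impI)
    fix t assume t: "?k \<le> t"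
    have "x (t + 1) = x t + (\<Sum>j<?k. beta_opt n m L j *\<^sub>R (x (t - j) - x (t - j - 1)))
        - (\<Sum>j\<le>?k. alpha_opt n m L j *\<^sub>R (\<Delta> *v (x (t - j) - xs (t - j))))"
      using rec t unfolding recursion_def grad by blast
    moreover have "(\<Sum>j<?k. beta_opt n m L j *\<^sub>R ((x (t - j) - xs (t - j)) - (x (t - j - 1) - xs (t - j - 1))))
        = (\<Sum>j<?k. beta_opt n m L j *\<^sub>R (x (t - j) - x (t - j - 1)))
          - (\<Sum>j<?k. beta_opt n m L j *\<^sub>R (xs (t - j) - xs (t - j - 1)))"
      by (simp add: sum_subtractf[symmetric] scaleR_diff_right algebra_simps)
    ultimately show "x (t + 1) - xs (t + 1) = (x t - xs t)
        + (\<Sum>j<?k. beta_opt n m L j *\<^sub>R ((x (t - j) - xs (t - j)) - (x (t - j - 1) - xs (t - j - 1))))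
        - (\<Sum>j\<le>?k. alpha_opt n m L j *\<^sub>R (\<Delta> *v (x (t - j) - xs (t - j))))"
      using traj[OF t] by simp
  qed
  thus "(\<lambda>t. x t - xs t) \<longlonglongrightarrow> 0"
    by (rule recursion_linear_tendsto_0) (unfold spectral_radius_companion_opt[OF \<Delta>], rule rho_less_1)
qed

end

theorem theorem2:
  fixes n :: nat and m L :: real
  assumes "n \<ge> 1" and "0 < m" and "m < L"
  shows
    "let \<kappa> = L / m;
         good = (\<lambda>k \<alpha> \<beta>.
           (\<Sum>j\<le>k. \<alpha> j) \<noteq> 0 \<and>
           (\<forall>f \<in> (quad_class n m L :: (real ^ 'p::finite \<Rightarrow> nat \<Rightarrow> real) set).
              \<forall>xs. quad_cost n m L xs f \<longrightarrow> globally_convergent k \<alpha> \<beta> f xs) \<and>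
           conv_rate TYPE('p) k \<alpha> \<beta> m L = ((sqrt \<kappa> - 1) / (sqrt \<kappa> + 1)) powr (1 / real n) \<and>
           conv_rate TYPE('p) k \<alpha> \<beta> m L
             = ((sqrt L - sqrt m) / (sqrt L + sqrt m)) powr (1 / real n))
     in (\<exists>k\<ge>1. \<exists>\<alpha> \<beta>. good k \<alpha> \<beta>) \<and>
        good (2 * n - 1) (alpha_opt n m L) (beta_opt n m L)"
proof -
  have "(sqrt (L / m) - 1) / (sqrt (L / m) + 1) = (sqrt L - sqrt m) / (sqrt L + sqrt m)"
  proof -
    have "sqrt m > 0" "sqrt L > 0" using assms by simp_all
    thus ?thesis
      unfolding real_sqrt_divide by (simp add: divide_simps add_pos_pos)
  qed
  moreover have "2 * n - 1 \<ge> 1" using assms(1) by simp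
  ultimately show ?thesis
    unfolding Let_def
    using sum_alpha_opt_neq_0[OF assms] globally_convergent_opt[OF assms]
      conv_rate_opt[OF assms, where 'p = 'p, unfolded rho_def]
    by (metis (no_types, lifting))
qed

end
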